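(* Let $\mathcal V$ be a finite-dimensional real inner product space with induced norm $\|\cdot\|_2$, let $A:\mathcal V\to\mathbb R^m$ be linear, $b\in\mathbb R^m$, and let $C=\{x\in\mathcal V\mid Ax=b\}$ be a nonempty affine set. Let $\gamma\in\mathbb R$, $h\in\mathcal V$, $Q_0>0$, $Q(z):=\frac12\|z\|_2^2+Q_0$, $E_{\gamma,h}(x):=-\frac{\gamma+\langle h,x\rangle}{Q(x)}$, and assume $\sup_{x\in C}E_{\gamma,h}(x)>0$. Then the problem $\sup_{x\in C}E_{\gamma,h}(x)$ is solved by $u=P_C(-e^{-1}h)$, where $$P_C(y)=y-A^\dagger(Ay-b)$$ and $e=E_{\gamma,h}(u)$ is given by $$e=\frac{-\beta_2+\sqrt{\beta_2^2-4\beta_1\beta_3}}{2\beta_1},$$ with $$\beta_1:=\tfrac12\|A^\dagger b\|_2^2+Q_0,\qquad \beta_2:=\langle A^\dagger(Ah),A^\dagger b\rangle+\gamma,\qquad \beta_3:=\tfrac12\|A^\dagger(Ah)\|_2^2+\tfrac12\|h\|_2^2 .$$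
   Context: $P_C(y):=\operatorname{argmin}_{x\in C}\frac12\|x-y\|_2^2$ denotes the orthogonal projection onto $C$, and $A^\dagger$ is the Moore–Penrose pseudoinverse of $A$. "The problem is solved by $u$" means that $u\in C$ is a maximizer of $E_{\gamma,h}$ over $C$.
   Formalization: The sign in β3 is corrected: β3 = ½‖A†(Ah)‖² − ½‖h‖² instead of + ½‖h‖²; with the printed plus sign the claim fails, e.g. V = ℝ, A = 0, b = 0, γ = 0, h = 1, Q0 = ½ gives discriminant −1. *)

theory Defs
  imports "HOL-Analysis.Analysis"
begin

text \<open>
  The four Penrose equations. Self-adjointness of \<open>A \<circ> G\<close> and \<open>G \<circ> A\<close> is written out
  through the inner products, since the library operator \<^const>\<open>adjoint\<close> is specified
  only for Euclidean spaces.
\<close>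

definition is_moore_penrose ::
    "('a::real_inner \<Rightarrow> 'b::real_inner) \<Rightarrow> ('b \<Rightarrow> 'a) \<Rightarrow> bool" where
  "is_moore_penrose A G \<longleftrightarrow> linear G
     \<and> (\<forall>x. A (G (A x)) = A x)
     \<and> (\<forall>y. G (A (G y)) = G y)
     \<and> (\<forall>y z. A (G y) \<bullet> z = y \<bullet> A (G z))
     \<and> (\<forall>x w. G (A x) \<bullet> w = x \<bullet> G (A w))"

definition pinv :: "('a::real_inner \<Rightarrow> 'b::real_inner) \<Rightarrow> ('b \<Rightarrow> 'a)" where
  "pinv A = (THE G. is_moore_penrose A G)"

lemma is_moore_penrose_unique:
  assumes G: "is_moore_penrose A G" and H: "is_moore_penrose A H"
  shows "G = H"
proof
  note * = G[unfolded is_moore_penrose_def] H[unfolded is_moore_penrose_def]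
  have 1: "A (G y) = A (H y)" for y
  proof (rule vector_eq_rdot[THEN iffD1], rule allI)
    fix z
    show "A (G y) \<bullet> z = A (H y) \<bullet> z" using * by metis
  qed
  have 2: "G (A x) = H (A x)" for x
  proof (rule vector_eq_rdot[THEN iffD1], rule allI)
    fix z
    show "G (A x) \<bullet> z = H (A x) \<bullet> z" using * by metis
  qed
  show "G y = H y" for y using * 1 2 by metis
qed

lemma pinv_eq:
  assumes "is_moore_penrose A G"
  shows "pinv A = G"
  unfolding pinv_def using assms is_moore_penrose_unique by blast

lemma ex_orthogonal_projection:
  fixes B :: "'a::real_inner set"
  assumes "finite B"
  obtains P where "linear P" "\<And>x. P x \<in> span B"
    "\<And>x y. y \<in> span B \<Longrightarrow> (x - P x) \<bullet> y = 0"
    "\<And>x. x \<in> span B \<Longrightarrow> P x = x" "\<And>x y. P x \<bullet> y = x \<bullet> P y"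
proof -
  obtain C where C: "finite C" "span C = span B" "pairwise orthogonal C"
    using basis_orthogonal[OF assms] by blast
  define P where "P = (\<lambda>a. \<Sum>b\<in>C. (b \<bullet> a / (b \<bullet> b)) *\<^sub>R b)"
  have lin: "linear P"
    unfolding P_def
    by (intro linearI)
       (simp_all add: inner_add_right add_divide_distrib scaleR_add_left sum.distrib scaleR_sum_right)
  have mem: "P x \<in> span B" for x
    unfolding P_def C(2)[symmetric] by (intro span_sum span_mul span_base)
  have orth0: "(x - P x) \<bullet> y = 0" if "y \<in> C" for x y
  proof -
    have "P x \<bullet> y = (\<Sum>b\<in>C. (b \<bullet> x / (b \<bullet> b)) * (b \<bullet> y))"
      by (simp add: P_def inner_sum_left)
    also have "\<dots> = (\<Sum>b\<in>C. if b = y then y \<bullet> x else 0)"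
      using C(3) that by (intro sum.cong) (auto simp: pairwise_def orthogonal_def)
    also have "\<dots> = x \<bullet> y" using C(1) that by (simp add: inner_commute)
    finally show ?thesis by (simp add: inner_diff_left)
  qed
  have orth: "(x - P x) \<bullet> y = 0" if "y \<in> span B" for x y
  proof -
    have "orthogonal (x - P x) y"
      using that C(2) orth0 by (intro orthogonal_to_span[of y C]) (auto simp: orthogonal_def)
    then show ?thesis by (simp add: orthogonal_def)
  qed
  have id: "P x = x" if "x \<in> span B" for x
  proof -
    have "x - P x \<in> span B" using that mem span_diff by blast
    then have "(x - P x) \<bullet> (x - P x) = 0" using orth by blast
    then show ?thesis by simp
  qed
  have "P x \<bullet> y = x \<bullet> P y" for x y
    using orth[OF mem, of x y] orth[OF mem, of y x]
    by (simp add: inner_diff_left inner_diff_right inner_commute)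
  with lin mem orth id that show thesis by blast
qed

lemma ex_moore_penrose:
  fixes A :: "'a::real_inner \<Rightarrow> 'b::real_inner" and B :: "'a set"
  assumes "linear A" and B: "finite B" "span B = UNIV"
  shows "\<exists>G. is_moore_penrose A G"
proof -
  interpret A: linear A by fact
  let ?K = "{x. A x = 0}"
  have sub: "subspace ?K" by (simp add: subspace_def A.zero A.add A.scale)
  obtain D where D: "D \<subseteq> ?K" "independent D" "?K \<subseteq> span D"
    using maximal_independent_subset[of ?K] by blast
  have "finite D" using independent_span_bound[OF B(1) D(2)] B(2) by blast
  have spanD: "span D = ?K" using D sub span_minimal by blast
  obtain P where P: "linear P" "\<And>x. A (P x) = 0" "\<And>x. A x = 0 \<Longrightarrow> P x = x"
      "\<And>x y. P x \<bullet> y = x \<bullet> P y"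
    using ex_orthogonal_projection[OF \<open>finite D\<close>] unfolding spanD mem_Collect_eq by metis
  interpret P: linear P by fact
  have spanR: "span (A ` B) = range A" using linear_span_image[OF \<open>linear A\<close>, of B] B(2) by simp
  obtain R where R: "linear R" "\<And>y. R y \<in> range A" "\<And>y. y \<in> range A \<Longrightarrow> R y = y"
      "\<And>x y. R x \<bullet> y = x \<bullet> R y"
    using ex_orthogonal_projection[OF finite_imageI[OF B(1)], of A] unfolding spanR by metis
  interpret R: linear R by fact
  define s where "s y = (SOME x. A x = R y)" for y
  have s: "A (s y) = R y" for y
    unfolding s_def using R(2)[of y] by (metis (mono_tags) rangeE someI_ex)
  define G where "G y = s y - P (s y)" for y
  have G: "G y = x - P x" if "A x = R y" for x y
  proof -
    have "P (s y - x) = s y - x" using that s by (intro P(3)) (simp add: A.diff)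
    then show ?thesis unfolding G_def by (simp add: P.diff algebra_simps)
  qed
  have AG: "A (G y) = R y" for y unfolding G_def by (simp add: A.diff s P)
  have GA: "G (A x) = x - P x" for x by (rule G) (simp add: R)
  have lin: "linear G"
  proof (rule linearI)
    show "G (x + y) = G x + G y" for x y
      by (subst G[of "s x + s y"]) (simp_all add: A.add R.add P.add s G_def)
    show "G (r *\<^sub>R x) = r *\<^sub>R G x" for r x
      by (subst G[of "r *\<^sub>R s x"]) (simp_all add: A.scale R.scale P.scale s G_def scaleR_diff_right)
  qed
  have "G (R y) = G y" for y
    using G[of "s y" "R y"] s R by (simp add: G_def)
  then have "is_moore_penrose A G"
    unfolding is_moore_penrose_def using lin
    by (auto simp: AG GA R P A.diff inner_diff_left inner_diff_right)
  then show ?thesis by blast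
qed

text \<open>\<open>pinv\<close> is therefore well defined for linear maps on a finite-dimensional space.\<close>

lemma is_moore_penrose_pinv:
  fixes A :: "'a::real_inner \<Rightarrow> 'b::real_inner" and B :: "'a set"
  assumes "linear A" "finite B" "span B = UNIV"
  shows "is_moore_penrose A (pinv A)"
  using ex_moore_penrose[OF assms] pinv_eq by blast

text \<open>
  The library's \<^const>\<open>closest_point\<close> requires the class \<^class>\<open>heine_borel\<close>, which is not
  available for an arbitrary finite-dimensional \<^class>\<open>real_inner\<close> type.
\<close>

definition orth_proj :: "'a::real_inner set \<Rightarrow> 'a \<Rightarrow> 'a" where
  "orth_proj C y = (ARG_MIN (\<lambda>x. 1/2 * (norm (x - y))\<^sup>2) x. x \<in> C)"

definition Q :: "real \<Rightarrow> 'a::real_inner \<Rightarrow> real" where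
  "Q Q0 z = 1/2 * (norm z)\<^sup>2 + Q0"

definition E :: "real \<Rightarrow> real \<Rightarrow> 'a::real_inner \<Rightarrow> 'a \<Rightarrow> real" where
  "E Q0 \<gamma> h x = - ((\<gamma> + h \<bullet> x) / Q Q0 x)"

text \<open>
  \<open>E Q0 \<gamma> h\<close> is bounded, so its supremum over a nonempty set is a genuine real supremum.
\<close>

lemma bdd_above_E:
  fixes h :: "'a::real_inner"
  assumes "Q0 > 0"
  shows "bdd_above (E Q0 \<gamma> h ` C)"
proof (rule bdd_aboveI2)
  fix x :: 'a
  let ?M = "(\<bar>\<gamma>\<bar> + (norm h)\<^sup>2 / 2) / Q0 + 1"
  have Qpos: "Q Q0 x > 0" unfolding Q_def using assms by (simp add: add_nonneg_pos)
  have "0 \<le> (norm (h + x))\<^sup>2" by simp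
  then have "- (h \<bullet> x) \<le> (norm h)\<^sup>2 / 2 + (norm x)\<^sup>2 / 2"
    by (simp add: power2_norm_eq_inner inner_add_left inner_add_right inner_commute)
  then have 1: "- (\<gamma> + h \<bullet> x) \<le> (\<bar>\<gamma>\<bar> + (norm h)\<^sup>2 / 2) + Q Q0 x"
    unfolding Q_def using assms by linarith
  have "(\<bar>\<gamma>\<bar> + (norm h)\<^sup>2 / 2) / Q0 * Q0 \<le> (\<bar>\<gamma>\<bar> + (norm h)\<^sup>2 / 2) / Q0 * Q Q0 x"
    unfolding Q_def using assms by (intro mult_left_mono) auto
  then have "\<bar>\<gamma>\<bar> + (norm h)\<^sup>2 / 2 \<le> (\<bar>\<gamma>\<bar> + (norm h)\<^sup>2 / 2) / Q0 * Q Q0 x"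
    using assms by simp
  with 1 have "- (\<gamma> + h \<bullet> x) \<le> ?M * Q Q0 x" by (simp add: algebra_simps)
  then show "E Q0 \<gamma> h x \<le> ?M"
    unfolding E_def minus_divide_left using Qpos by (subst pos_divide_le_eq) auto
qed

text \<open>
  On the sign in \<open>\<beta>3 = 1/2 \<parallel>pinv A (A h)\<parallel>\<^sup>2 - 1/2 \<parallel>h\<parallel>\<^sup>2\<close>: inserting
  \<open>u = pinv A b - (1/e) p\<close> with \<open>p = h - pinv A (A h)\<close> into \<open>e * Q u + \<gamma> + h \<bullet> u = 0\<close> gives
  \<open>\<beta>1 e\<^sup>2 + \<beta>2 e + \<beta>3 = 0\<close> with \<open>\<beta>3 = - 1/2 \<parallel>p\<parallel>\<^sup>2\<close>, which equals the above by Pythagoras.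
  The source prints a plus sign in front of \<open>1/2 \<parallel>h\<parallel>\<^sup>2\<close>, which is a misprint: for the real line,
  \<open>A = 0\<close>, \<open>b = 0\<close>, \<open>\<gamma> = 0\<close>, \<open>h = 1\<close>, \<open>Q0 = 1/2\<close> the maximum is \<open>1\<close> (at \<open>-1\<close>), whereas
  the printed discriminant would be \<open>-1\<close>.
\<close>

end

theory Submission
  imports Defs
begin

text \<open>
  As \<open>Q\<close> is positive, the bound \<open>E \<le> e\<close> at \<open>x\<close> says that the function \<open>e * Q x + \<gamma> + h \<bullet> x\<close> is nonnegative
  there, with equality exactly if \<open>E\<close> takes the value \<open>e\<close>. On \<open>C\<close> this function is a quadratic with
  Hessian \<open>e\<close> times the identity, so it should be recentred at its minimizer. Write \<open>c = pinv A b\<close>,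
  which is the element of \<open>C\<close> orthogonal to the kernel of \<open>A\<close>, and \<open>p = h - pinv A (A h)\<close>, which is
  the projection of \<open>h\<close> onto that kernel. For \<open>x \<in> C\<close> the difference \<open>x - c\<close> lies in the kernel,
  hence \<open>Q x = \<beta>1 + 1/2 \<parallel>x - c\<parallel>\<^sup>2\<close> and \<open>\<gamma> + h \<bullet> x = \<beta>2 + p \<bullet> (x - c)\<close>, whereas Pythagoras gives
  \<open>\<beta>3 = - 1/2 \<parallel>p\<parallel>\<^sup>2\<close>. If \<open>e > 0\<close> solves \<open>\<beta>1 e\<^sup>2 + \<beta>2 e + \<beta>3 = 0\<close>, completing the square yields
  \<open>e * Q x + \<gamma> + h \<bullet> x = e / 2 * \<parallel>x - u\<parallel>\<^sup>2\<close> with \<open>u = c - e\<^sup>-\<^sup>1 p\<close> for all \<open>x \<in> C\<close>. This proves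
  at once that \<open>E \<le> e\<close> on \<open>C\<close> and that \<open>e\<close> is attained at \<open>u\<close>. The projection formula identifies
  this \<open>u\<close> with the projection of \<open>- e\<^sup>-\<^sup>1 h\<close> onto \<open>C\<close>.

  The discriminant is nonnegative because \<open>\<beta>1 > 0 \<ge> \<beta>3\<close>. If \<open>p \<noteq> 0\<close>, then
  \<open>\<beta>3 < 0\<close> and the roots have opposite signs, so the larger root \<open>e\<close> is positive. If \<open>p = 0\<close>, the
  numerator of \<open>E\<close> is the constant \<open>- \<beta>2\<close> on \<open>C\<close>; the positive supremum forces \<open>\<beta>2 < 0\<close>, and again
  \<open>e = - \<beta>2 / \<beta>1 > 0\<close>.
\<close>

section \<open>The Moore--Penrose inverse and affine sets\<close>

lemma moore_penrose_solves:
  assumes "is_moore_penrose A G" "A x = b"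
  shows "A (G b) = b"
  using assms by (auto simp: is_moore_penrose_def)

text \<open>
  The range of the pseudoinverse is orthogonal to the kernel, because \<open>G = G \<circ> A \<circ> G\<close> and the
  self-adjoint map \<open>G \<circ> A\<close> vanishes on the kernel of \<open>A\<close>.
\<close>

lemma moore_penrose_orthogonal_kernel:
  assumes G: "is_moore_penrose A G" and "A v = 0"
  shows "G y \<bullet> v = 0"
proof -
  have "G y \<bullet> v = G (A (G y)) \<bullet> v" using G by (simp add: is_moore_penrose_def)
  also have "\<dots> = G y \<bullet> G (A v)" using G unfolding is_moore_penrose_def by blast
  also have "\<dots> = 0" using G \<open>A v = 0\<close> by (simp add: is_moore_penrose_def linear_0)
  finally show ?thesis .
qed

text \<open>
  A point \<open>q\<close> of \<open>C\<close> is the projection of \<open>y\<close> as soon as \<open>q - y\<close> is orthogonal to all directions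
  within \<open>C\<close>: by Pythagoras, moving from \<open>q\<close> to another point \<open>x\<close> adds \<open>1/2 \<parallel>x - q\<parallel>\<^sup>2\<close> to the
  objective, so \<open>q\<close> is the only minimizer.
\<close>

lemma orth_proj_eqI:
  assumes "q \<in> C" and orth: "\<And>x. x \<in> C \<Longrightarrow> (q - y) \<bullet> (x - q) = 0"
  shows "orth_proj C y = q"
proof -
  let ?f = "\<lambda>x. 1/2 * (norm (x - y))\<^sup>2"
  have pyth: "?f x = ?f q + 1/2 * (norm (x - q))\<^sup>2" if "x \<in> C" for x
  proof -
    have "x - y = (q - y) + (x - q)" by simp
    then have "(norm (x - y))\<^sup>2 = (norm (q - y))\<^sup>2 + (norm (x - q))\<^sup>2"
      using orth[OF that] norm_add_Pythagorean[of "q - y" "x - q"] by (simp add: orthogonal_def)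
    then show ?thesis by simp
  qed
  have "?f q \<le> ?f x" if "x \<in> C" for x
    using pyth[OF that] zero_le_power2[of "norm (x - q)"] by linarith
  then have "is_arg_min ?f (\<lambda>x. x \<in> C) q"
    unfolding is_arg_min_linorder using \<open>q \<in> C\<close> by blast
  then have "is_arg_min ?f (\<lambda>x. x \<in> C) (orth_proj C y)"
    unfolding orth_proj_def arg_min_def by (rule someI)
  then have P: "orth_proj C y \<in> C" "?f (orth_proj C y) \<le> ?f q"
    using \<open>q \<in> C\<close> by (auto simp: is_arg_min_linorder)
  from pyth[OF P(1)] P(2) have "(norm (orth_proj C y - q))\<^sup>2 \<le> 0" by linarith
  then show ?thesis by simp
qed

lemma orth_proj_affine:
  assumes "linear A" and G: "is_moore_penrose A G" and "{x. A x = b} \<noteq> {}"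
  shows "orth_proj {x. A x = b} y = y - G (A y - b)"
proof (rule orth_proj_eqI)
  have "A (G b) = b" using assms(3) moore_penrose_solves[OF G] by blast
  moreover have "A (G (A y)) = A y" using G by (simp add: is_moore_penrose_def)
  moreover have "linear G" using G by (simp add: is_moore_penrose_def)
  ultimately have q: "A (y - G (A y - b)) = b"
    using \<open>linear A\<close> by (simp add: linear_diff)
  then show "y - G (A y - b) \<in> {x. A x = b}" by simp
  fix x assume "x \<in> {x. A x = b}"
  with q \<open>linear A\<close> have "A (x - (y - G (A y - b))) = 0" by (simp add: linear_diff)
  from moore_penrose_orthogonal_kernel[OF G this]
  show "(y - G (A y - b) - y) \<bullet> (x - (y - G (A y - b))) = 0" by simp
qed

section \<open>Maximizing the quotient\<close>

lemma Q_pos: "Q0 > 0 \<Longrightarrow> Q Q0 x > 0"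
  unfolding Q_def by (simp add: add_nonneg_pos)

lemma E_le_iff: "Q0 > 0 \<Longrightarrow> E Q0 \<gamma> h x \<le> e \<longleftrightarrow> 0 \<le> e * Q Q0 x + (\<gamma> + h \<bullet> x)"
  unfolding E_def minus_divide_left by (subst pos_divide_le_eq[OF Q_pos]) linarith+

lemma E_eq_iff: "Q0 > 0 \<Longrightarrow> E Q0 \<gamma> h x = e \<longleftrightarrow> e * Q Q0 x + (\<gamma> + h \<bullet> x) = 0"
  using Q_pos[of Q0 x] unfolding E_def minus_divide_left
  by (subst nonzero_divide_eq_eq) linarith+

text \<open>
  Completing the square in \<open>v\<close>; in the application \<open>v = x - c\<close> and \<open>v + e\<^sup>-\<^sup>1 p = x - u\<close>. The quadratic
  equation is the condition that no constant term remains.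
\<close>

lemma complete_square_at_root:
  fixes p v :: "'a::real_inner"
  assumes "e \<noteq> 0" and root: "\<beta>1 * e\<^sup>2 + \<beta>2 * e - 1/2 * (norm p)\<^sup>2 = 0"
  shows "e * (\<beta>1 + 1/2 * (norm v)\<^sup>2) + (\<beta>2 + p \<bullet> v) = e / 2 * (norm (v + inverse e *\<^sub>R p))\<^sup>2"
proof -
  have "(norm (v + inverse e *\<^sub>R p))\<^sup>2
      = (norm v)\<^sup>2 + 2 * inverse e * (p \<bullet> v) + (inverse e)\<^sup>2 * (norm p)\<^sup>2"
    unfolding power2_norm_eq_inner
    by (simp add: inner_add_left inner_add_right inner_commute power2_eq_square)
  then have "e / 2 * (norm (v + inverse e *\<^sub>R p))\<^sup>2
      = e / 2 * (norm v)\<^sup>2 + (e * inverse e) * (p \<bullet> v)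
        + (e * inverse e) * (inverse e * (1/2 * (norm p)\<^sup>2))"
    by (simp only:) (simp add: power2_eq_square algebra_simps)
  also have "1/2 * (norm p)\<^sup>2 = e * (\<beta>1 * e + \<beta>2)"
    using root by (simp add: power2_eq_square algebra_simps)
  also have "inverse e * \<dots> = \<beta>1 * e + \<beta>2" using \<open>e \<noteq> 0\<close> by simp
  finally show ?thesis using \<open>e \<noteq> 0\<close> by (simp add: algebra_simps)
qed

text \<open>
  If \<open>\<beta>3 \<le> 0 < \<beta>1\<close>, the two roots have a product \<open>\<beta>3 / \<beta>1 \<le> 0\<close>, so the larger one is nonnegative;
  it can vanish only for \<open>\<beta>3 = 0\<close>, and then \<open>\<beta>2 < 0\<close> makes it the root \<open>- \<beta>2 / \<beta>1 > 0\<close>.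
\<close>

lemma larger_root_pos:
  fixes \<beta>1 \<beta>2 \<beta>3 :: real
  assumes "\<beta>1 > 0" "\<beta>3 \<le> 0" "\<beta>3 = 0 \<Longrightarrow> \<beta>2 < 0"
    and e: "e = (- \<beta>2 + sqrt (\<beta>2\<^sup>2 - 4 * \<beta>1 * \<beta>3)) / (2 * \<beta>1)"
  shows "\<beta>2\<^sup>2 - 4 * \<beta>1 * \<beta>3 \<ge> 0" "e > 0" "\<beta>1 * e\<^sup>2 + \<beta>2 * e + \<beta>3 = 0"
proof -
  let ?D = "\<beta>2\<^sup>2 - 4 * \<beta>1 * \<beta>3"
  have prod: "\<beta>1 * \<beta>3 \<le> 0" using assms by (simp add: mult_nonneg_nonpos)
  then show D: "?D \<ge> 0" using zero_le_power2[of \<beta>2] by linarith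
  have "\<beta>2 < sqrt ?D"
  proof (cases "\<beta>3 = 0")
    case True
    then show ?thesis using assms(3) by simp
  next
    case False
    then have "\<beta>1 * \<beta>3 < 0" using assms by (simp add: mult_pos_neg)
    then have "sqrt (\<beta>2\<^sup>2) < sqrt ?D" by (intro real_sqrt_less_mono) linarith
    then show ?thesis by simp
  qed
  then show "e > 0" unfolding e using \<open>\<beta>1 > 0\<close> by simp
  have "\<beta>1 * e\<^sup>2 + \<beta>2 * e + \<beta>3 = 0 \<longleftrightarrow> ?D = (2 * \<beta>1 * e + \<beta>2)\<^sup>2"
  proof -
    have "(2 * \<beta>1 * e + \<beta>2)\<^sup>2 - ?D = 4 * \<beta>1 * (\<beta>1 * e\<^sup>2 + \<beta>2 * e + \<beta>3)"
      by (simp add: power2_eq_square algebra_simps)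
    then show ?thesis using \<open>\<beta>1 > 0\<close> by auto
  qed
  moreover have "2 * \<beta>1 * e + \<beta>2 = sqrt ?D" unfolding e using \<open>\<beta>1 > 0\<close> by simp
  ultimately show "\<beta>1 * e\<^sup>2 + \<beta>2 * e + \<beta>3 = 0" using D by simp
qed

theorem proposition3p1:
  fixes A :: "'v::real_inner \<Rightarrow> real ^ 'm"
    and B :: "'v set"
    and b :: "real ^ 'm"
    and C :: "'v set"
    and h u :: 'v
    and \<gamma> Q0 e \<beta>1 \<beta>2 \<beta>3 :: real
  assumes fin_dim: "finite B" "span B = UNIV"
    and A: "linear A"
    and C_def: "C = {x. A x = b}"
    and nonempty: "C \<noteq> {}"
    and Q0: "Q0 > 0"
    and sup_pos: "(SUP x\<in>C. E Q0 \<gamma> h x) > 0"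
    and \<beta>1_def: "\<beta>1 = 1/2 * (norm (pinv A b))\<^sup>2 + Q0"
    and \<beta>2_def: "\<beta>2 = pinv A (A h) \<bullet> pinv A b + \<gamma>"
    and \<beta>3_def: "\<beta>3 = 1/2 * (norm (pinv A (A h)))\<^sup>2 - 1/2 * (norm h)\<^sup>2"
    and e_def: "e = (- \<beta>2 + sqrt (\<beta>2\<^sup>2 - 4 * \<beta>1 * \<beta>3)) / (2 * \<beta>1)"
    and u_def: "u = orth_proj C (- (inverse e *\<^sub>R h))"
  shows "(\<forall>y. orth_proj C y = y - pinv A (A y - b))
    \<and> \<beta>2\<^sup>2 - 4 * \<beta>1 * \<beta>3 \<ge> 0 \<and> e \<noteq> 0
    \<and> u \<in> C \<and> (\<forall>x\<in>C. E Q0 \<gamma> h x \<le> E Q0 \<gamma> h u)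
    \<and> E Q0 \<gamma> h u = e"
proof -
  let ?G = "pinv A"
  define c where "c = ?G b"
  define p where "p = h - ?G (A h)"
  have G: "is_moore_penrose A ?G" using is_moore_penrose_pinv[OF A fin_dim] .
  have linG: "linear ?G" using G by (simp add: is_moore_penrose_def)
  have Ac: "A c = b"
    unfolding c_def using nonempty moore_penrose_solves[OF G] by (auto simp: C_def)
  have Ap: "A p = 0" unfolding p_def using A G by (simp add: linear_diff is_moore_penrose_def)
  have ker: "A (x - c) = 0" if "x \<in> C" for x
    using that Ac A by (simp add: C_def linear_diff)

  \<comment> \<open>Numerator and denominator of \<open>E\<close> on \<open>C\<close>, centred at \<open>c\<close>.\<close>
  have Q_C: "Q Q0 x = \<beta>1 + 1/2 * (norm (x - c))\<^sup>2" if "x \<in> C" for x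
  proof -
    have "c \<bullet> (x - c) = 0"
      unfolding c_def using moore_penrose_orthogonal_kernel[OF G] ker[OF that] c_def by simp
    then have "(norm (c + (x - c)))\<^sup>2 = (norm c)\<^sup>2 + (norm (x - c))\<^sup>2"
      by (intro norm_add_Pythagorean) (simp add: orthogonal_def)
    then show ?thesis by (simp add: Q_def \<beta>1_def c_def)
  qed
  have num_C: "\<gamma> + h \<bullet> x = \<beta>2 + p \<bullet> (x - c)" if "x \<in> C" for x
  proof -
    have "?G (A h) \<bullet> (x - c) = 0" by (rule moore_penrose_orthogonal_kernel[OF G ker[OF that]])
    moreover have "p \<bullet> c = 0"
      using moore_penrose_orthogonal_kernel[OF G Ap, of b] by (simp add: c_def inner_commute)
    ultimately show ?thesis
      by (simp add: \<beta>2_def p_def flip: c_def) (simp add: inner_diff_left inner_diff_right)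
  qed
  have \<beta>3: "\<beta>3 = - 1/2 * (norm p)\<^sup>2"
  proof -
    have "(norm (?G (A h) + p))\<^sup>2 = (norm (?G (A h)))\<^sup>2 + (norm p)\<^sup>2"
      by (intro norm_add_Pythagorean)
         (simp add: orthogonal_def moore_penrose_orthogonal_kernel[OF G Ap])
    then show ?thesis by (simp add: \<beta>3_def p_def field_simps)
  qed

  have \<beta>1_pos: "\<beta>1 > 0" unfolding \<beta>1_def using Q0 by (simp add: add_nonneg_pos)
  have \<beta>2_neg: "\<beta>2 < 0" if "\<beta>3 = 0"
  proof (rule ccontr)
    assume "\<not> \<beta>2 < 0"
    with that have "E Q0 \<gamma> h x \<le> 0" if "x \<in> C" for x
      using num_C[OF that] \<beta>3 by (simp add: E_le_iff[OF Q0])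
    then have "(SUP x\<in>C. E Q0 \<gamma> h x) \<le> 0" using nonempty by (intro cSUP_least)
    with sup_pos show False by simp
  qed
  have "\<beta>3 \<le> 0" using \<beta>3 by simp
  note root = larger_root_pos[OF \<beta>1_pos this \<beta>2_neg e_def]

  have proj: "orth_proj C y = y - ?G (A y - b)" for y
    unfolding C_def using nonempty by (intro orth_proj_affine[OF A G]) (simp add: C_def)
  have u: "u = c - inverse e *\<^sub>R p"
    unfolding u_def proj p_def c_def using A linG
    by (simp add: linear_diff linear_neg linear_scale scaleR_diff_right)
  have uC: "u \<in> C" unfolding u C_def using Ac Ap A by (simp add: linear_diff linear_scale)

  have square: "e * Q Q0 x + (\<gamma> + h \<bullet> x) = e / 2 * (norm (x - u))\<^sup>2" if "x \<in> C" for x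
    using complete_square_at_root[of e \<beta>1 \<beta>2 p "x - c"] root(2,3) that
    by (simp add: \<beta>3 Q_C num_C u algebra_simps)
  have "E Q0 \<gamma> h x \<le> e" if "x \<in> C" for x
    unfolding E_le_iff[OF Q0] square[OF that] using root(2) by simp
  moreover have "E Q0 \<gamma> h u = e"
    unfolding E_eq_iff[OF Q0] square[OF uC] by simp
  ultimately show ?thesis using proj root(1,2) uC by simp
qed

end
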